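(* Let $A=(A_1,\dots,A_d)$ be a tuple of (real symmetric) positive semi-definite $m\times m$ matrices, and consider the power series expansion in $x\in\mathbb{R}^d$ $$L(x)=\exp(-x_1A_1-\dots-x_dA_d)=\sum_{\alpha\in\mathbb{N}_0^d}C_\alpha x^\alpha .$$ Then $L$ is completely monotone in the operator sense, that is, $(-1)^{|\alpha|}C_\alpha\ge0$ (positive semi-definite) for all $\alpha\in\mathbb{N}_0^d$, if and only if the matrices $A_j$ mutually commute.
   Context: For $\alpha\in\mathbb{N}_0^d$, $|\alpha|=\sum_j\alpha_j$ and $x^\alpha=\prod_jx_j^{\alpha_j}$. The coefficients $C_\alpha$ are $m\times m$ matrices, and $\ge 0$ refers to the usual ordering of symmetric matrices. *)

theory Defs
  imports "HOL-Analysis.Analysis"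
begin

(* The class operations times and power on the type real^'m^'m act entrywise (Hadamard), so
   matrix powers and the matrix exponential are built from the matrix product ** instead of
   the library constants power and exp. *)

primrec matrix_power :: "real^'m^'m \<Rightarrow> nat \<Rightarrow> real^'m^'m" where
  "matrix_power M 0 = mat 1"
| "matrix_power M (Suc k) = M ** matrix_power M k"

definition matrix_exp :: "real^'m^'m \<Rightarrow> real^'m^'m" where
  "matrix_exp M = (\<Sum>k. (1 / fact k) *\<^sub>R matrix_power M k)"

definition pos_semidef :: "real^'m^'m \<Rightarrow> bool" where
  "pos_semidef M \<longleftrightarrow> transpose M = M \<and> (\<forall>v. 0 \<le> v \<bullet> (M *v v))"

definition multi_deg :: "nat^'d \<Rightarrow> nat" where
  "multi_deg \<alpha> = (\<Sum>j\<in>UNIV. \<alpha> $ j)"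

definition monomial :: "real^'d \<Rightarrow> nat^'d \<Rightarrow> real" where
  "monomial x \<alpha> = (\<Prod>j\<in>UNIV. x $ j ^ (\<alpha> $ j))"

(* The convergence is unconditional and is required at every point of R^d. *)
definition power_series_expansion ::
    "(real^'d \<Rightarrow> real^'m^'m) \<Rightarrow> (nat^'d \<Rightarrow> real^'m^'m) \<Rightarrow> bool" where
  "power_series_expansion L C \<longleftrightarrow>
     (\<forall>x. ((\<lambda>\<alpha>. monomial x \<alpha> *\<^sub>R C \<alpha>) has_sum L x) UNIV)"

definition exp_family :: "('d \<Rightarrow> real^'m^'m) \<Rightarrow> real^'d \<Rightarrow> real^'m^'m" where
  "exp_family A x = matrix_exp (- (\<Sum>j\<in>UNIV. x $ j *\<^sub>R A j))"

end

theory Submission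
  imports Defs
begin

text \<open>Expanding \<open>matrix_exp\<close> into products along words in the indices and collecting the words
  with a given multidegree \<open>\<alpha>\<close> gives the coefficients: \<open>(- 1) ^ multi_deg \<alpha> *\<^sub>R C \<alpha>\<close> is a positive
  multiple of the sum of these word products. If the \<open>A j\<close> commute, each word product is a product of
  commuting positive semidefinite matrices, hence positive semidefinite. Conversely, it suffices to
  look at the multidegrees \<open>k e\<^sub>i + e\<^sub>j\<close>, where the sum is \<open>\<Sum>a\<le>k. A\<^sub>i\<^sup>a A\<^sub>j A\<^sub>i\<^sup>k\<^sup>-\<^sup>a\<close>. Testing it with
  eigenvectors \<open>u\<close>, \<open>w\<close> of \<open>A\<^sub>i\<close> for eigenvalues \<open>a < b\<close>, the off-diagonal entry is at least
  \<open>b\<^sup>k \<bar>u \<bullet> A\<^sub>j w\<bar>\<close>, whereas the diagonal entries are \<open>O(k a\<^sup>k)\<close> and \<open>O(k b\<^sup>k)\<close>. By Cauchy--Schwarz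
  \<open>u \<bullet> A\<^sub>j w = 0\<close>, so \<open>A\<^sub>j\<close> preserves the eigenspaces of \<open>A\<^sub>i\<close>.\<close>

section \<open>Uniqueness of multivariate power series\<close>

text \<open>Tagging each \<open>a\<close> with \<open>h a\<close> turns \<open>A\<close> into the
  disjoint union of the fibers of \<open>h\<close>. Regrouping by an exponent, by word length and by
  multidegree all rest on this.\<close>

lemma has_sum_fibers:
  fixes f :: "'a \<Rightarrow> 'c::real_normed_vector"
  assumes "(f has_sum s) A" "\<And>b. (f has_sum g b) {a \<in> A. h a = b}"
  shows "(g has_sum s) UNIV"
proof (rule has_sum_Sigma[OF isUCont_plus, where f = "\<lambda>(b, a). f a" and B = "\<lambda>b. {a \<in> A. h a = b}"])
  have img: "(\<lambda>a. (h a, a)) ` A = Sigma UNIV (\<lambda>b. {a \<in> A. h a = b})" by auto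
  have "inj_on (\<lambda>a. (h a, a)) A" by (auto intro: inj_onI)
  from has_sum_reindex[OF this, of "\<lambda>(b, a). f a" s] assms(1)
  show "((\<lambda>(b, a). f a) has_sum s) (Sigma UNIV (\<lambda>b. {a \<in> A. h a = b}))"
    by (simp add: img o_def)
qed (use assms(2) in simp)

text \<open>Once the coefficients below \<open>n\<close> vanish, the series can be divided by
  \<open>t ^ n\<close> for \<open>t \<noteq> 0\<close>; the quotient tends to \<open>a n\<close> as
  \<open>t\<close> tends to 0.\<close>

lemma powser_zero_imp_coeff_zero:
  fixes a :: "nat \<Rightarrow> real"
  assumes "\<And>t. (\<lambda>n. a n * t ^ n) sums 0"
  shows "a n = 0"
proof (induction n rule: less_induct)
  case (less n)
  have "(\<lambda>k. a (k + n) * t ^ k) sums 0" if "t \<noteq> 0" for t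
  proof -
    have "(\<lambda>k. a (k + n) * t ^ (k + n)) sums (0 - (\<Sum>k<n. a k * t ^ k))"
      by (rule sums_split_initial_segment[OF assms])
    then have "(\<lambda>k. a (k + n) * t ^ (k + n)) sums 0"
      using less by simp
    from sums_mult[OF this, of "inverse (t ^ n)"] that show ?thesis
      by (simp add: power_add field_simps)
  qed
  then have "((\<lambda>t::real. 0::real) \<longlongrightarrow> a (0 + n)) (at 0)"
    by (intro powser_limit_0_strong[where s = 1]) auto
  then show ?case
    by (simp add: tendsto_const_iff)
qed

lemma monomial_fun_upd:
  fixes x :: "real^'d"
  shows "monomial (\<chi> i. if i = j then t * x $ i else x $ i) \<alpha> = monomial x \<alpha> * t ^ (\<alpha> $ j)"
proof -
  have "monomial (\<chi> i. if i = j then t * x $ i else x $ i) \<alpha> =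
      (\<Prod>i\<in>UNIV. x $ i ^ (\<alpha> $ i) * (if i = j then t ^ (\<alpha> $ i) else 1))"
    unfolding monomial_def by (intro prod.cong) (auto simp: power_mult_distrib)
  then show ?thesis
    by (simp add: monomial_def prod.distrib)
qed

text \<open>Scaling the \<open>j\<close>-th variable by \<open>t\<close> and regrouping by the exponent \<open>\<alpha> $ j\<close> gives a vanishing power
  series in \<open>t\<close>; so the exponents can be fixed one variable at a time.\<close>

lemma multi_power_series_zero:
  fixes D :: "nat^'d \<Rightarrow> real"
  assumes "\<And>x. ((\<lambda>\<alpha>. monomial x \<alpha> * D \<alpha>) has_sum 0) UNIV"
  shows "D \<beta> = 0"
proof -
  have partial: "((\<lambda>\<alpha>. monomial x \<alpha> * D \<alpha>) has_sum 0) {\<alpha>. \<forall>j\<in>J. \<alpha> $ j = \<beta> $ j}"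
    if "finite J" for x J
    using that
  proof (induction J arbitrary: x)
    case empty
    then show ?case using assms by simp
  next
    case (insert j J)
    let ?S = "{\<alpha>. \<forall>j\<in>J. \<alpha> $ j = \<beta> $ j}"
    let ?f = "\<lambda>\<alpha>. monomial x \<alpha> * D \<alpha>"
    define a where "a n = infsum ?f {\<alpha> \<in> ?S. \<alpha> $ j = n}" for n
    have "?f summable_on ?S"
      using insert.IH summable_on_def by blast
    then have a: "(?f has_sum a n) {\<alpha> \<in> ?S. \<alpha> $ j = n}" for n
      unfolding a_def by (intro has_sum_infsum) (rule summable_on_subset_banach, auto)
    have "(\<lambda>n. a n * t ^ n) sums 0" for t
    proof (rule has_sum_imp_sums, rule has_sum_fibers[where h = "\<lambda>\<alpha>. \<alpha> $ j"])
      show "((\<lambda>\<alpha>. ?f \<alpha> * t ^ (\<alpha> $ j)) has_sum 0) ?S"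
        using insert.IH[of "\<chi> i. if i = j then t * x $ i else x $ i"]
        by (simp add: monomial_fun_upd mult_ac)
      show "((\<lambda>\<alpha>. ?f \<alpha> * t ^ (\<alpha> $ j)) has_sum a n * t ^ n) {\<alpha> \<in> ?S. \<alpha> $ j = n}" for n
        using has_sum_cmult_left[OF a[of n], of "t ^ n"]
        by (subst has_sum_cong[where g = "\<lambda>\<alpha>. ?f \<alpha> * t ^ n"]) auto
    qed
    then have "a (\<beta> $ j) = 0"
      by (rule powser_zero_imp_coeff_zero)
    with a[of "\<beta> $ j"] show ?case
      by (auto simp: conj_commute)
  qed
  have "{\<alpha>. \<forall>j\<in>UNIV. \<alpha> $ j = \<beta> $ j} = {\<beta>}"
    by (auto simp: vec_eq_iff)
  \<comment> \<open>At the all-ones vector every monomial equals 1, so the one remaining term is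
    \<open>D \<beta>\<close>.\<close>
  then have "((\<lambda>\<alpha>. monomial 1 \<alpha> * D \<alpha>) has_sum 0) {\<beta>}"
    using partial[of UNIV 1] by simp
  moreover have "((\<lambda>\<alpha>. monomial 1 \<alpha> * D \<alpha>) has_sum (\<Sum>\<alpha>\<in>{\<beta>}. monomial 1 \<alpha> * D \<alpha>)) {\<beta>}"
    by (rule has_sum_finite) simp
  ultimately have "(\<Sum>\<alpha>\<in>{\<beta>}. monomial 1 \<alpha> * D \<alpha>) = 0"
    by (rule has_sum_unique[rotated])
  then show ?thesis
    by (simp add: monomial_def)
qed

lemma power_series_expansion_unique:
  fixes C C' :: "nat^'d \<Rightarrow> real^'m^'m"
  assumes "power_series_expansion L C" "power_series_expansion L C'"
  shows "C = C'"
proof -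
  have "(C \<alpha> - C' \<alpha>) $ p $ q = 0" for \<alpha> p q
  proof (rule multi_power_series_zero[of "\<lambda>\<alpha>. (C \<alpha> - C' \<alpha>) $ p $ q"])
    fix x
    have "((\<lambda>\<alpha>. monomial x \<alpha> *\<^sub>R C \<alpha> - monomial x \<alpha> *\<^sub>R C' \<alpha>) has_sum L x - L x) UNIV"
      using assms unfolding power_series_expansion_def diff_conv_add_uminus
      by (intro has_sum_add) (auto simp: has_sum_uminus)
    then have "((\<lambda>\<alpha>. monomial x \<alpha> *\<^sub>R (C \<alpha> - C' \<alpha>)) has_sum 0) UNIV"
      by (simp add: scaleR_diff_right)
    from has_sum_bounded_linear[OF bounded_linear_vec_nth has_sum_bounded_linear[OF bounded_linear_vec_nth this],
        of p q]
    show "((\<lambda>\<alpha>. monomial x \<alpha> * (C \<alpha> - C' \<alpha>) $ p $ q) has_sum 0) UNIV"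
      by (simp only: vector_scaleR_component real_scaleR_def zero_index)
  qed
  then show ?thesis
    by (simp add: fun_eq_iff vec_eq_iff)
qed

section \<open>Symmetric and positive semidefinite matrices\<close>

lemma symmetric_inner_matrix:
  fixes M :: "real^'m^'m"
  assumes "transpose M = M"
  shows "u \<bullet> (M *v v) = (M *v u) \<bullet> v"
  using dot_lmul_matrix[of u M v] vector_transpose_matrix[of u M] assms by simp

text \<open>A maximiser \<open>v\<close> of the Rayleigh quotient over the subspace is an eigenvector: perturbing \<open>v\<close>
  in the direction \<open>w = M v - \<lambda> v\<close>, which lies in the subspace and is orthogonal to \<open>v\<close>, shows that
  \<open>w\<close> is orthogonal to \<open>M v\<close>, hence to itself.\<close>

lemma symmetric_eigenvector_max:
  fixes M :: "real^'m^'m"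
  assumes sym: "transpose M = M"
    and S: "subspace S" "S \<noteq> {0}" "\<And>v. v \<in> S \<Longrightarrow> M *v v \<in> S"
  obtains v l where "v \<in> S" "v \<noteq> 0" "M *v v = l *\<^sub>R v" "\<And>w. w \<in> S \<Longrightarrow> w \<bullet> (M *v w) \<le> l * (w \<bullet> w)"
proof -
  let ?q = "\<lambda>w. w \<bullet> (M *v w)"
  let ?K = "S \<inter> sphere 0 1"
  have "compact ?K"
    using S(1) by (intro closed_Int_compact closed_subspace) auto
  moreover obtain z where "z \<in> S" "z \<noteq> 0"
    using S(1,2) subspace_0 by blast
  then have "(1 / norm z) *\<^sub>R z \<in> ?K"
    using S(1) by (auto intro: subspace_scale)
  then have "?K \<noteq> {}" by blast
  moreover have "continuous_on ?K ?q"
    by (intro continuous_intros linear_continuous_on matrix_vector_mul_bounded_linear)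
  ultimately obtain v where v: "v \<in> ?K" and vmax: "\<And>w. w \<in> ?K \<Longrightarrow> ?q w \<le> ?q v"
    using continuous_attains_sup[of ?K ?q] by blast
  define l where "l = ?q v"
  have vv: "v \<bullet> v = 1" using v by (simp add: dot_square_norm)
  have max: "?q w \<le> l * (w \<bullet> w)" if "w \<in> S" for w
  proof (cases "w = 0")
    case False
    have "(1 / norm w) *\<^sub>R w \<in> ?K"
      using that False S(1) by (auto intro: subspace_scale)
    from vmax[OF this] have "?q w / (norm w)\<^sup>2 \<le> l"
      by (simp add: l_def matrix_vector_mult_scaleR power2_eq_square)
    then show ?thesis
      using False by (simp add: divide_le_eq dot_square_norm)
  qed auto
  define w where "w = M *v v - l *\<^sub>R v"
  have wS: "w \<in> S"
    unfolding w_def using v S by (auto intro: subspace_diff subspace_scale)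
  have vw: "v \<bullet> w = 0"
    by (simp add: w_def inner_diff_right vv l_def)
  have wMv: "w \<bullet> (M *v v) = w \<bullet> w"
    using vw by (simp add: w_def inner_diff_right inner_commute)
  have *: "2 * t * (w \<bullet> w) \<le> t\<^sup>2 * (l * (w \<bullet> w) - ?q w)" for t
  proof -
    have "v + t *\<^sub>R w \<in> S"
      using v wS S(1) by (auto intro: subspace_add subspace_scale)
    from max[OF this]
    have "?q v + 2 * t * (w \<bullet> (M *v v)) + t\<^sup>2 * ?q w \<le> l * (v \<bullet> v + t\<^sup>2 * (w \<bullet> w))"
      using symmetric_inner_matrix[OF sym, of v w] vw
      by (simp add: matrix_vector_right_distrib matrix_vector_mult_scaleR inner_add_left
          inner_add_right inner_commute power2_eq_square algebra_simps)
    then show ?thesis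
      by (simp add: wMv vv l_def algebra_simps)
  qed
  have "w \<bullet> w = 0"
  proof (rule ccontr)
    assume "w \<bullet> w \<noteq> 0"
    then have pos: "w \<bullet> w > 0" by simp
    \<comment> \<open>\<open>c\<close> bounds the coefficient of \<open>t\<^sup>2\<close> in the
      perturbation inequality, and the \<open>+ 1\<close> keeps it positive. The choice
      \<open>t = w \<bullet> w / c\<close> turns the right side into
      \<open>t * (w \<bullet> w)\<close>, half of the left side.\<close>
    define c where "c = \<bar>l * (w \<bullet> w) - ?q w\<bar> + 1"
    have c: "c > 0" "l * (w \<bullet> w) - ?q w \<le> c" unfolding c_def by linarith+
    define t where "t = w \<bullet> w / c"
    have "2 * t * (w \<bullet> w) \<le> t\<^sup>2 * c"
      using *[of t] c(2) by (smt (verit) mult_left_mono zero_le_power2)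
    also have "\<dots> = t * (w \<bullet> w)"
      using c(1) by (simp add: t_def power2_eq_square)
    finally show False
      using mult_pos_pos[OF pos pos] c(1) by (simp add: t_def field_simps del: inner_eq_zero_iff)
  qed
  then have "M *v v = l *\<^sub>R v"
    by (simp add: w_def)
  moreover have "v \<noteq> 0" using vv by auto
  ultimately show ?thesis
    using that v max by blast
qed

text \<open>By symmetry the orthogonal complement of all eigenvectors is invariant under
  \<open>M\<close>. If it were nonzero it would contain an eigenvector, which would be orthogonal to
  itself.\<close>

lemma span_eigenvectors_symmetric:
  fixes M :: "real^'m^'m"
  assumes sym: "transpose M = M"
  shows "span {v. \<exists>l. M *v v = l *\<^sub>R v} = UNIV"
proof (rule ccontr)
  let ?E = "{v. \<exists>l. M *v v = l *\<^sub>R v}"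
  define S where "S = {x. \<forall>v\<in>?E. x \<bullet> v = 0}"
  assume "span ?E \<noteq> UNIV"
  then have "span ?E \<subset> span UNIV" by (simp add: psubset_eq)
  then obtain x where x: "x \<noteq> 0" "\<And>y. y \<in> span ?E \<Longrightarrow> orthogonal x y"
    by (rule orthogonal_to_subspace_exists_gen) blast
  have "x \<bullet> v = 0" if "v \<in> ?E" for v
    using x(2)[OF span_base[OF that]] by (simp add: orthogonal_def)
  then have "x \<in> S" by (simp add: S_def)
  then have "S \<noteq> {0}" using x by blast
  moreover have "subspace S"
    unfolding S_def subspace_def by (auto simp: inner_add_left)
  moreover have "M *v x \<in> S" if "x \<in> S" for x
    using that unfolding S_def by (auto simp: symmetric_inner_matrix[OF sym, symmetric])
  ultimately obtain v l where v: "v \<in> S" "v \<noteq> 0" "M *v v = l *\<^sub>R v"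
    using symmetric_eigenvector_max[OF sym] by metis
  then show False
    unfolding S_def by force
qed

text \<open>If \<open>M ** N\<close> had a negative eigenvalue, its eigenspace would be invariant under \<open>N\<close>, hence contain
  an eigenvector of \<open>N\<close>, on which \<open>M\<close> would be negative.\<close>

lemma pos_semidef_mult_commuting:
  fixes M N :: "real^'m^'m"
  assumes M: "pos_semidef M" and N: "pos_semidef N" and comm: "M ** N = N ** M"
  shows "pos_semidef (M ** N)"
proof -
  have sym: "transpose M = M" "transpose N = N"
    using M N by (auto simp: pos_semidef_def)
  have symMN: "transpose (M ** N) = M ** N"
    by (simp add: matrix_transpose_mul sym comm)
  have neg: "(- P) *v v = - (P *v v)" for P :: "real^'m^'m" and v
    by (simp add: vec_eq_iff matrix_vector_mult_def sum_negf)
  have "transpose (- (M ** N)) = - (M ** N)"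
    using symMN by (simp add: vec_eq_iff transpose_def)
  \<comment> \<open>\<open>l\<close> is the largest eigenvalue of \<open>- (M ** N)\<close>, so
    \<open>l \<le> 0\<close> gives the claim.\<close>
  then obtain v l where v: "v \<noteq> 0" "(- (M ** N)) *v v = l *\<^sub>R v"
      and max: "\<And>w. w \<bullet> (- (M ** N) *v w) \<le> l * (w \<bullet> w)"
    by (rule symmetric_eigenvector_max[where S = UNIV]) (auto intro: axis_eq_0_iff)
  have "l \<le> 0"
  proof (rule ccontr)
    assume "\<not> l \<le> 0"
    define E where "E = {v. (M ** N) *v v = (- l) *\<^sub>R v}"
    have "subspace E"
      unfolding subspace_def E_def
      by (auto simp: matrix_vector_right_distrib matrix_vector_mult_scaleR algebra_simps)
    moreover have "(M ** N) *v v = - ((- (M ** N)) *v v)"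
      by (simp add: neg)
    then have "v \<in> E"
      unfolding E_def v(2) by simp
    then have "E \<noteq> {0}" using v(1) by blast
    moreover have "N *v u \<in> E" if "u \<in> E" for u
    proof -
      have "(M ** N) *v (N *v u) = N *v ((M ** N) *v u)"
        by (simp only: matrix_vector_mul_assoc) (metis matrix_mul_assoc comm)
      then show ?thesis
        using that matrix_vector_mult_scaleR[of N "- l" u] by (simp add: E_def)
    qed
    ultimately obtain u b where u: "u \<in> E" "u \<noteq> 0" "N *v u = b *\<^sub>R u"
      using symmetric_eigenvector_max[OF sym(2)] by metis
    have uu: "u \<bullet> u > 0" using u by simp
    have "0 \<le> b * (u \<bullet> u)"
      using N u(3) by (metis pos_semidef_def inner_scaleR_right)
    then have b: "b \<ge> 0" using uu by (simp add: zero_le_mult_iff)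
    have "b * (u \<bullet> (M *v u)) = u \<bullet> ((M ** N) *v u)"
      by (simp add: matrix_vector_mul_assoc[symmetric] u(3) matrix_vector_mult_scaleR)
    also have "\<dots> = - l * (u \<bullet> u)"
      using u(1) by (simp add: E_def)
    also have "\<dots> < 0" using uu \<open>\<not> l \<le> 0\<close> by (simp add: mult_pos_pos)
    finally show False
      using b M by (simp add: pos_semidef_def mult_less_0_iff) (meson not_less)
  qed
  then have "0 \<le> w \<bullet> ((M ** N) *v w)" for w
    using max[of w] mult_nonpos_nonneg[of l "w \<bullet> w"] by (simp add: neg)
  with symMN show ?thesis
    by (simp add: pos_semidef_def)
qed

lemma pos_semidef_cauchy_schwarz:
  fixes M :: "real^'m^'m"
  assumes "pos_semidef M"
  shows "(u \<bullet> (M *v w))\<^sup>2 \<le> (u \<bullet> (M *v u)) * (w \<bullet> (M *v w))"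
proof -
  define a b c where "a = u \<bullet> (M *v u)" "b = u \<bullet> (M *v w)" "c = w \<bullet> (M *v w)"
  have sym: "transpose M = M" and pos: "\<And>v. 0 \<le> v \<bullet> (M *v v)"
    using assms by (auto simp: pos_semidef_def)
  have wu: "w \<bullet> (M *v u) = b"
    using symmetric_inner_matrix[OF sym, of w u] by (simp add: a_b_c_def inner_commute)
  have quad: "0 \<le> s\<^sup>2 * a + 2 * s * t * b + t\<^sup>2 * c" for s t
    using pos[of "s *\<^sub>R u + t *\<^sub>R w"] wu
    by (simp add: a_b_c_def matrix_vector_right_distrib matrix_vector_mult_scaleR inner_add_left
        inner_add_right power2_eq_square algebra_simps)
  have "a \<ge> 0" using pos by (simp add: a_b_c_def)
  have "b\<^sup>2 \<le> a * c"
  proof (cases "a = 0")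
    case True
    have "b = 0"
    proof (rule ccontr)
      assume "b \<noteq> 0"
      \<comment> \<open>For \<open>a = 0\<close> the form is linear in \<open>s\<close>; this
        \<open>s\<close> gives it the value -1.\<close>
      with quad[of "- (c + 1) / (2 * b)" 1] True show False
        by (simp add: field_simps)
    qed
    then show ?thesis using True by simp
  next
    case False
    with \<open>a \<ge> 0\<close> have "a > 0" by simp
    \<comment> \<open>The form is evaluated at \<open>b u - a w\<close>, which is orthogonal to
      \<open>u\<close> with respect to \<open>M\<close>.\<close>
    have "0 \<le> a * (a * c - b\<^sup>2)"
      using quad[of b "- a"] by (simp add: power2_eq_square algebra_simps)
    with \<open>a > 0\<close> show ?thesis
      by (simp add: zero_le_mult_iff)
  qed
  then show ?thesis by (simp add: a_b_c_def)
qed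

section \<open>Sandwich sums and commutation\<close>

lemma inner_matrix_power_eigenvector:
  fixes M :: "real^'m^'m"
  assumes "transpose M = M" "M *v u = a *\<^sub>R u"
  shows "u \<bullet> (matrix_power M k *v v) = a ^ k * (u \<bullet> v)"
  by (induction k)
    (simp_all add: matrix_vector_mul_assoc[symmetric] symmetric_inner_matrix[OF assms(1)] assms(2))

lemma matrix_power_eigenvector:
  assumes "M *v u = a *\<^sub>R u"
  shows "matrix_power M k *v u = a ^ k *\<^sub>R u"
  by (induction k)
    (simp_all add: matrix_vector_mul_assoc[symmetric] assms matrix_vector_mult_scaleR mult.commute)

lemma matrix_vector_mult_sum_left:
  fixes f :: "'a \<Rightarrow> real^'m^'n"
  shows "(\<Sum>i\<in>I. f i) *v v = (\<Sum>i\<in>I. f i *v v)"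
  by (induction I rule: infinite_finite_induct) (auto simp: matrix_vector_mult_add_rdistrib)

text \<open>This is the sum of all words with \<open>k\<close> letters \<open>A\<close> and one
  letter \<open>B\<close>, the part of the expansion that is of degree one in
  \<open>B\<close>.\<close>

definition sandwich_sum :: "real^'m^'m \<Rightarrow> real^'m^'m \<Rightarrow> nat \<Rightarrow> real^'m^'m" where
  "sandwich_sum A B k = (\<Sum>i\<le>k. matrix_power A i ** B ** matrix_power A (k - i))"

lemma inner_sandwich_sum:
  fixes A B :: "real^'m^'m"
  assumes "transpose A = A" "A *v u = a *\<^sub>R u" "A *v w = b *\<^sub>R w"
  shows "u \<bullet> (sandwich_sum A B k *v w) = (\<Sum>i\<le>k. a ^ i * b ^ (k - i)) * (u \<bullet> (B *v w))"
  by (simp add: sandwich_sum_def matrix_vector_mult_sum_left matrix_vector_mul_assoc[symmetric]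
      matrix_power_eigenvector[OF assms(3)] inner_sum_right matrix_vector_mult_scaleR
      inner_matrix_power_eigenvector[OF assms(1,2)] sum_distrib_left mult_ac)

lemma eigenvector_nonneg:
  fixes A :: "real^'m^'m"
  assumes "pos_semidef A" "A *v u = a *\<^sub>R u" "u \<noteq> 0"
  shows "a \<ge> 0"
proof -
  have "0 \<le> a * (u \<bullet> u)"
    using assms(1,2) by (metis pos_semidef_def inner_scaleR_right)
  moreover have "u \<bullet> u > 0" using assms(3) by simp
  ultimately show ?thesis by (simp add: zero_le_mult_iff)
qed

text \<open>In Cauchy--Schwarz for the \<open>k\<close>-th sandwich sum the left side grows like \<open>b ^ (2 * k)\<close>, the
  right side only like \<open>k\<^sup>2 * (a * b) ^ k\<close>.\<close>

lemma sandwich_sum_orthogonal: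
  fixes A B :: "real^'m^'m"
  assumes A: "pos_semidef A" and psd: "\<And>k. pos_semidef (sandwich_sum A B k)"
    and u: "A *v u = a *\<^sub>R u" and w: "A *v w = b *\<^sub>R w" and "u \<noteq> 0" and "a < b"
  shows "u \<bullet> (B *v w) = 0"
proof -
  have sym: "transpose A = A" using A by (simp add: pos_semidef_def)
  have "a \<ge> 0" by (rule eigenvector_nonneg[OF A u \<open>u \<noteq> 0\<close>])
  with \<open>a < b\<close> have "b > 0" by simp
  define s U W where "s = u \<bullet> (B *v w)" "U = u \<bullet> (B *v u)" "W = w \<bullet> (B *v w)"
  have diag: "(\<Sum>i\<le>k. c ^ i * c ^ (k - i)) = (real k + 1) * c ^ k" for c :: real and k
    by (simp add: power_add[symmetric])
  have bound: "s\<^sup>2 \<le> (real k + 1)\<^sup>2 * (a / b) ^ k * (U * W)" for k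
  proof -
    define p where "p = (\<Sum>i\<le>k. a ^ i * b ^ (k - i))"
    \<comment> \<open>The term \<open>i = 0\<close> alone contributes \<open>b ^ k\<close>, and all
      others are nonnegative.\<close>
    have "(\<Sum>i\<in>{0}. a ^ i * b ^ (k - i)) \<le> p"
      unfolding p_def using \<open>a \<ge> 0\<close> \<open>b > 0\<close> by (intro sum_mono2) auto
    then have p: "b ^ k \<le> p" by simp
    have "(b ^ k)\<^sup>2 * s\<^sup>2 \<le> p\<^sup>2 * s\<^sup>2"
      using p \<open>b > 0\<close> by (intro mult_right_mono power_mono) auto
    also have "\<dots> \<le> ((real k + 1) * a ^ k * U) * ((real k + 1) * b ^ k * W)"
      using pos_semidef_cauchy_schwarz[OF psd[of k], of u w]
      by (simp add: inner_sandwich_sum[OF sym u u] inner_sandwich_sum[OF sym w w]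
          inner_sandwich_sum[OF sym u w] diag s_U_W_def p_def power_mult_distrib)
    also have "\<dots> = (b ^ k)\<^sup>2 * ((real k + 1)\<^sup>2 * (a / b) ^ k * (U * W))"
      using \<open>b > 0\<close> by (simp add: power2_eq_square power_divide field_simps)
    finally show ?thesis
      using \<open>b > 0\<close> by simp
  qed
  have "(\<lambda>k. (real k + 1)\<^sup>2 * (a / b) ^ k) \<longlonglongrightarrow> 0"
  proof -
    \<comment> \<open>With the square root, the sequence is the square of
      \<open>k r ^ k + r ^ k\<close>, and both of these terms tend to 0.\<close>
    define r where "r = sqrt (a / b)"
    have "0 \<le> a / b" "a / b < 1"
      using \<open>a \<ge> 0\<close> \<open>b > 0\<close> \<open>a < b\<close> by auto
    then have r: "r\<^sup>2 = a / b" "norm r < 1"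
      by (auto simp: r_def)
    have "(\<lambda>k. of_nat k * r ^ k + r ^ k) \<longlonglongrightarrow> 0 + 0"
      using r(2) by (intro tendsto_add powser_times_n_limit_0 LIMSEQ_power_zero)
    then have "(\<lambda>k. (of_nat k * r ^ k + r ^ k)\<^sup>2) \<longlonglongrightarrow> (0 + 0)\<^sup>2"
      by (intro tendsto_power)
    moreover have "(of_nat k * r ^ k + r ^ k)\<^sup>2 = (real k + 1)\<^sup>2 * (a / b) ^ k" for k
    proof -
      have "of_nat k * r ^ k + r ^ k = (real k + 1) * r ^ k"
        by (simp add: algebra_simps)
      then show ?thesis
        by (simp add: power_mult_distrib r(1)[symmetric] power_mult[symmetric] mult.commute)
    qed
    ultimately show ?thesis by simp
  qed
  then have "(\<lambda>k. (real k + 1)\<^sup>2 * (a / b) ^ k * (U * W)) \<longlonglongrightarrow> 0 * (U * W)"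
    by (intro tendsto_mult tendsto_const)
  then have "s\<^sup>2 \<le> 0 * (U * W)"
    by (rule LIMSEQ_le_const) (use bound in auto)
  then show ?thesis by (simp add: s_U_W_def)
qed

text \<open>For eigenvectors \<open>u\<close>, \<open>w\<close> of \<open>A\<close> with eigenvalues
  \<open>a\<close>, \<open>b\<close>, the inner product of \<open>A B u - a B u\<close> with
  \<open>w\<close> is \<open>(b - a) * (u \<bullet> (B *v w)) = 0\<close>. Since eigenvectors span,
  \<open>A B u = a B u = B A u\<close>, and then \<open>A B = B A\<close> everywhere.\<close>

lemma sandwich_sum_pos_semidef_imp_commute:
  fixes A B :: "real^'m^'m"
  assumes A: "pos_semidef A" and psd: "\<And>k. pos_semidef (sandwich_sum A B k)"
  shows "A ** B = B ** A"
proof -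
  have symA: "transpose A = A" using A by (simp add: pos_semidef_def)
  have "B = sandwich_sum A B 0" by (simp add: sandwich_sum_def)
  then have symB: "transpose B = B" using psd[of 0] by (simp add: pos_semidef_def)
  let ?E = "{v. \<exists>l. A *v v = l *\<^sub>R v}"
  have eig: "(A ** B) *v u = (B ** A) *v u" if "u \<in> ?E" for u
  proof -
    from that obtain a where a: "A *v u = a *\<^sub>R u" by blast
    have "orthogonal (A *v (B *v u) - a *\<^sub>R (B *v u)) w" if "w \<in> ?E" for w
    proof -
      from that obtain b where b: "A *v w = b *\<^sub>R w" by blast
      have "(b - a) * (u \<bullet> (B *v w)) = 0"
      proof (cases "u = 0 \<or> w = 0 \<or> a = b")
        case False
        then consider "a < b" | "b < a" by linarith
        then show ?thesis
        proof cases
          case 1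
          then show ?thesis using sandwich_sum_orthogonal[OF A psd a b] False by simp
        next
          case 2
          then have "w \<bullet> (B *v u) = 0" using sandwich_sum_orthogonal[OF A psd b a] False by simp
          then show ?thesis
            using symmetric_inner_matrix[OF symB, of w u] by (simp add: inner_commute)
        qed
      qed auto
      moreover have "(A *v (B *v u)) \<bullet> w = b * (u \<bullet> (B *v w))"
        using symmetric_inner_matrix[OF symA, of "B *v u" w] symmetric_inner_matrix[OF symB, of u w]
        by (simp add: b)
      ultimately show ?thesis
        using symmetric_inner_matrix[OF symB, of u w]
        by (simp add: orthogonal_def inner_diff_left left_diff_distrib)
    qed
    then have "orthogonal (A *v (B *v u) - a *\<^sub>R (B *v u)) w" if "w \<in> span ?E" for w
      using that by (meson orthogonal_to_span)
    then have "A *v (B *v u) - a *\<^sub>R (B *v u) = 0"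
      unfolding span_eigenvectors_symmetric[OF symA] using orthogonal_self by blast
    then show ?thesis
      by (simp add: matrix_vector_mul_assoc[symmetric] a matrix_vector_mult_scaleR)
  qed
  have "(A ** B) *v v = (B ** A) *v v" for v
    by (rule linear_eq_on_span[where B = ?E])
      (auto simp: span_eigenvectors_symmetric[OF symA] eig simp del: mem_Collect_eq)
  then show ?thesis
    by (simp add: matrix_eq)
qed

section \<open>Words and the matrix exponential\<close>

primrec word_prod :: "('d \<Rightarrow> real^'m^'m) \<Rightarrow> 'd list \<Rightarrow> real^'m^'m" where
  "word_prod A [] = mat 1"
| "word_prod A (j # w) = A j ** word_prod A w"

text \<open>The exponent vector of the monomial that a word becomes when its letters
  commute.\<close>

definition word_deg :: "'d list \<Rightarrow> nat^'d" where
  "word_deg w = (\<chi> j. count_list w j)"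

lemma matrix_mult_add_left:
  fixes M N :: "real^'m^'n"
  shows "(M + N) ** P = M ** P + N ** P"
  by (simp add: vec_eq_iff matrix_matrix_mult_def sum.distrib distrib_right)

lemma matrix_mult_scaleR_scaleR:
  fixes M :: "real^'m^'n"
  shows "(c *\<^sub>R M) ** (d *\<^sub>R N) = (c * d) *\<^sub>R (M ** N)"
  by (simp add: vec_eq_iff matrix_matrix_mult_def sum_distrib_left mult_ac)

lemma bilinear_matrix_mult: "bilinear ((**) :: real^'m^'m \<Rightarrow> real^'m^'m \<Rightarrow> real^'m^'m)"
  unfolding bilinear_def
  by (auto intro!: linearI simp: matrix_add_ldistrib matrix_mult_add_left matrix_scalar_ac
      scalar_matrix_assoc)

lemma lists_length_Suc: "{w. length w = Suc k} = (\<lambda>(j, w). j # w) ` (UNIV \<times> {w. length w = k})"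
  by (auto simp: length_Suc_conv image_iff)

lemma finite_lists_length: "finite {w :: 'd::finite list. length w = k}"
  using finite_lists_length_eq[of "UNIV :: 'd set" k] by simp

lemma sum_lists_length_Suc:
  fixes f :: "'d::finite list \<Rightarrow> 'b::comm_monoid_add"
  shows "(\<Sum>w | length w = Suc k. f w) = (\<Sum>j\<in>UNIV. \<Sum>w | length w = k. f (j # w))"
proof -
  have "inj_on (\<lambda>(j, w). j # w) (UNIV \<times> {w :: 'd list. length w = k})"
    by (auto intro: inj_onI)
  then show ?thesis
    unfolding lists_length_Suc sum.cartesian_product
    by (simp only: sum.reindex) (rule sum.cong, auto)
qed

lemma power_sum_words:
  fixes c :: "'d::finite \<Rightarrow> real"
  shows "(\<Sum>j\<in>UNIV. c j) ^ k = (\<Sum>w | length w = k. prod_list (map c w))"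
proof (induction k)
  case (Suc k)
  then show ?case
    by (simp add: sum_lists_length_Suc sum_product)
qed simp

lemma matrix_power_sum_words:
  fixes A :: "'d::finite \<Rightarrow> real^'m^'m"
  shows "matrix_power (\<Sum>j\<in>UNIV. A j) k = (\<Sum>w | length w = k. word_prod A w)"
proof (induction k)
  case (Suc k)
  then show ?case
    using bilinear_sum[OF bilinear_matrix_mult, of A UNIV "word_prod A" "{w. length w = k}"]
    by (simp add: sum_lists_length_Suc sum.cartesian_product)
qed simp

text \<open>Convergence is absolute: up to a constant, the norms of the word products are dominated
  by products of scalars \<open>c j\<close>, and summing these over all words of length
  \<open>k\<close> gives the terms of the scalar series for
  \<open>exp (\<Sum>j\<in>UNIV. c j)\<close>.\<close>

lemma word_prod_summable:
  fixes A :: "'d::finite \<Rightarrow> real^'m^'m"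
  shows "(\<lambda>w. (1 / fact (length w)) *\<^sub>R word_prod A w) summable_on UNIV"
proof -
  have "\<exists>K>0. \<forall>(M::real^'m^'m) (N::real^'m^'m). norm (M ** N) \<le> K * norm M * norm N"
    by (rule bilinear_bounded_pos[OF bilinear_matrix_mult])
  then obtain K where K: "K > 0" "\<And>(M::real^'m^'m) (N::real^'m^'m). norm (M ** N) \<le> K * norm M * norm N"
    by metis
  \<comment> \<open>\<open>K\<close> from the bilinear bound is absorbed once per letter;
    \<open>e\<close> accounts for the empty word.\<close>
  define c where "c j = K * norm (A j)" for j
  define e where "e = norm (mat 1 :: real^'m^'m)"
  have c0: "c j \<ge> 0" for j using K(1) by (simp add: c_def)
  have e0: "e \<ge> 0" by (simp add: e_def)
  have p0: "prod_list (map c w) \<ge> 0" for w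
    by (induction w) (auto simp: c0)
  have le: "norm (word_prod A w) \<le> prod_list (map c w) * e" for w
  proof (induction w)
    case (Cons j w)
    have "norm (A j ** word_prod A w) \<le> c j * norm (word_prod A w)"
      using K(2) by (simp add: c_def)
    also have "\<dots> \<le> c j * (prod_list (map c w) * e)"
      by (intro mult_left_mono Cons c0)
    finally show ?case by simp
  qed (simp add: e_def)
  define g where "g w = 1 / fact (length w) * (prod_list (map c w) * e)" for w
  have g0: "g w \<ge> 0" for w using p0 e0 by (simp add: g_def)
  have "g summable_on UNIV"
  proof (rule nonneg_bdd_above_summable_on)
    show "bdd_above (sum g ` {F. F \<subseteq> UNIV \<and> finite F})"
    proof (rule bdd_aboveI2)
      fix F assume "F \<in> {F :: 'd list set. F \<subseteq> UNIV \<and> finite F}"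
      then have F: "finite F" by simp
      \<comment> \<open>\<open>n\<close> exceeds every word length in \<open>F\<close>; inserting 0
        keeps \<open>Max\<close> meaningful for empty \<open>F\<close>.\<close>
      define n where "n = Suc (Max (insert 0 (length ` F)))"
      have "length w < n" if "w \<in> F" for w
        using F that by (auto simp: n_def less_Suc_eq_le intro!: Max_ge)
      then have sub: "F \<subseteq> (\<Union>k<n. {w. length w = k})" by auto
      have "sum g F \<le> sum g (\<Union>k<n. {w. length w = k})"
        by (intro sum_mono2 sub g0) (auto simp: finite_lists_length)
      also have "\<dots> = (\<Sum>k<n. \<Sum>w | length w = k. g w)"
        by (rule sum.UNION_disjoint) (auto simp: finite_lists_length)
      also have "\<dots> = (\<Sum>k<n. (\<Sum>j\<in>UNIV. c j) ^ k /\<^sub>R fact k * e)"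
        by (intro sum.cong refl)
          (simp add: g_def power_sum_words sum_distrib_left sum_distrib_right divide_inverse mult_ac)
      also have "\<dots> = (\<Sum>k<n. (\<Sum>j\<in>UNIV. c j) ^ k /\<^sub>R fact k) * e"
        by (simp add: sum_distrib_right)
      also have "\<dots> \<le> exp (\<Sum>j\<in>UNIV. c j) * e"
      proof (intro mult_right_mono e0)
        have "0 \<le> (\<Sum>j\<in>UNIV. c j)" by (intro sum_nonneg c0)
        then show "(\<Sum>k<n. (\<Sum>j\<in>UNIV. c j) ^ k /\<^sub>R fact k) \<le> exp (\<Sum>j\<in>UNIV. c j)"
          unfolding exp_def by (intro sum_le_suminf summable_exp_generic) auto
      qed
      finally show "sum g F \<le> exp (\<Sum>j\<in>UNIV. c j) * e" .
    qed
  qed (rule g0)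
  then have "(\<lambda>w. norm ((1 / fact (length w)) *\<^sub>R word_prod A w)) summable_on UNIV"
    by (rule summable_on_comparison_test) (auto simp: g_def intro!: divide_right_mono le)
  then show ?thesis
    by (rule abs_summable_summable)
qed

text \<open>Grouping the words by length recovers the defining series, whose \<open>k\<close>-th
  power expands into the words of length \<open>k\<close>.\<close>

lemma word_prod_has_sum_matrix_exp:
  fixes A :: "'d::finite \<Rightarrow> real^'m^'m"
  shows "((\<lambda>w. (1 / fact (length w)) *\<^sub>R word_prod A w) has_sum matrix_exp (\<Sum>j\<in>UNIV. A j)) UNIV"
proof -
  let ?f = "\<lambda>w. (1 / fact (length w)) *\<^sub>R word_prod A w"
  have f: "(?f has_sum infsum ?f UNIV) UNIV"
    by (intro has_sum_infsum word_prod_summable)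
  have "((\<lambda>k. (1 / fact k) *\<^sub>R matrix_power (\<Sum>j\<in>UNIV. A j) k) has_sum infsum ?f UNIV) UNIV"
  proof (rule has_sum_fibers[OF f, where h = length])
    fix k
    have "(?f has_sum (\<Sum>w | length w = k. ?f w)) {w. length w = k}"
      by (rule has_sum_finite) (rule finite_lists_length)
    then show "(?f has_sum (1 / fact k) *\<^sub>R matrix_power (\<Sum>j\<in>UNIV. A j) k) {w \<in> UNIV. length w = k}"
      by (simp add: matrix_power_sum_words scaleR_right.sum)
  qed
  then have "matrix_exp (\<Sum>j\<in>UNIV. A j) = infsum ?f UNIV"
    unfolding matrix_exp_def by (intro sums_unique[symmetric] has_sum_imp_sums)
  then show ?thesis using f by simp
qed

section \<open>Coefficients of the exponential family\<close>

lemma multi_deg_word_deg: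
  fixes w :: "'d::finite list"
  shows "multi_deg (word_deg w) = length w"
  by (simp add: multi_deg_def word_deg_def sum_count_set)

lemma finite_words_of_deg: "finite {w :: 'd::finite list. word_deg w = \<alpha>}"
  by (rule finite_subset[OF _ finite_lists_length[of "multi_deg \<alpha>"]])
    (auto simp: multi_deg_word_deg)

lemma word_prod_scaleR:
  fixes A :: "'d::finite \<Rightarrow> real^'m^'m"
  shows "word_prod (\<lambda>j. (- x $ j) *\<^sub>R A j) w =
    monomial x (word_deg w) *\<^sub>R ((- 1) ^ length w *\<^sub>R word_prod A w)"
proof (induction w)
  case Nil
  then show ?case by (simp add: monomial_def word_deg_def)
next
  case (Cons j w)
  have "monomial x (word_deg (j # w)) =
      (\<Prod>i\<in>UNIV. (if i = j then x $ i else 1) * x $ i ^ count_list w i)"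
    unfolding monomial_def word_deg_def by (intro prod.cong) auto
  then have "monomial x (word_deg (j # w)) = x $ j * monomial x (word_deg w)"
    by (simp add: prod.distrib monomial_def word_deg_def)
  moreover have "word_prod (\<lambda>j. (- x $ j) *\<^sub>R A j) (j # w) =
      ((- x $ j) *\<^sub>R A j) ** ((monomial x (word_deg w) * (- 1) ^ length w) *\<^sub>R word_prod A w)"
    by (simp only: word_prod.simps Cons scaleR_scaleR)
  ultimately show ?case
    by (simp only: matrix_mult_scaleR_scaleR) simp
qed

text \<open>All words of multidegree \<open>\<alpha>\<close> have length
  \<open>multi_deg \<alpha>\<close>, hence share sign and factorial. For commuting matrices this is
  the familiar coefficient \<open>(- 1) ^ multi_deg \<alpha>\<close> times \<open>A\<close> to the
  power \<open>\<alpha>\<close>, divided by the product of the factorials of the entries of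
  \<open>\<alpha>\<close>.\<close>

definition exp_coeff :: "('d::finite \<Rightarrow> real^'m^'m) \<Rightarrow> nat^'d \<Rightarrow> real^'m^'m" where
  "exp_coeff A \<alpha> = ((- 1) ^ multi_deg \<alpha> / fact (multi_deg \<alpha>)) *\<^sub>R (\<Sum>w | word_deg w = \<alpha>. word_prod A w)"

lemma power_series_expansion_exp_coeff:
  fixes A :: "'d::finite \<Rightarrow> real^'m^'m"
  shows "power_series_expansion (exp_family A) (exp_coeff A)"
  unfolding power_series_expansion_def
proof
  fix x
  let ?f = "\<lambda>w. (1 / fact (length w)) *\<^sub>R word_prod (\<lambda>j. (- x $ j) *\<^sub>R A j) w"
  have "(?f has_sum exp_family A x) UNIV"
    using word_prod_has_sum_matrix_exp[of "\<lambda>j. (- x $ j) *\<^sub>R A j"]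
    by (simp add: exp_family_def sum_negf)
  then show "((\<lambda>\<alpha>. monomial x \<alpha> *\<^sub>R exp_coeff A \<alpha>) has_sum exp_family A x) UNIV"
  proof (rule has_sum_fibers[where h = word_deg])
    fix \<alpha>
    have "(\<Sum>w | word_deg w = \<alpha>. ?f w) = monomial x \<alpha> *\<^sub>R exp_coeff A \<alpha>"
      unfolding exp_coeff_def scaleR_right.sum word_prod_scaleR
      by (intro sum.cong refl) (auto simp: multi_deg_word_deg[symmetric])
    then show "(?f has_sum monomial x \<alpha> *\<^sub>R exp_coeff A \<alpha>) {w \<in> UNIV. word_deg w = \<alpha>}"
      using has_sum_finite[OF finite_words_of_deg[of \<alpha>], of ?f] by simp
  qed
qed

lemma signed_exp_coeff:
  "(- 1) ^ multi_deg \<alpha> *\<^sub>R exp_coeff A \<alpha> =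
    (1 / fact (multi_deg \<alpha>)) *\<^sub>R (\<Sum>w | word_deg w = \<alpha>. word_prod A w)"
  by (simp add: exp_coeff_def power_add[symmetric])

section \<open>Semidefiniteness of word products\<close>

lemma pos_semidef_mat_1: "pos_semidef (mat 1)"
  by (simp add: pos_semidef_def)

lemma pos_semidef_scaleR: "pos_semidef M \<Longrightarrow> 0 \<le> c \<Longrightarrow> pos_semidef (c *\<^sub>R M)"
  by (simp add: pos_semidef_def transpose_scalar scaleR_matrix_vector_assoc[symmetric])

lemma pos_semidef_sum:
  fixes f :: "'a \<Rightarrow> real^'m^'m"
  assumes "\<And>i. i \<in> I \<Longrightarrow> pos_semidef (f i)"
  shows "pos_semidef (\<Sum>i\<in>I. f i)"
proof -
  have "transpose (\<Sum>i\<in>I. f i) = (\<Sum>i\<in>I. transpose (f i))"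
    by (simp add: vec_eq_iff transpose_def)
  with assms show ?thesis
    by (auto simp: pos_semidef_def matrix_vector_mult_sum_left inner_sum_right intro!: sum_nonneg)
qed

lemma word_prod_commute:
  assumes "\<And>i. M ** A i = A i ** M"
  shows "M ** word_prod A w = word_prod A w ** M"
proof (induction w)
  case (Cons j w)
  have "M ** (A j ** word_prod A w) = A j ** (M ** word_prod A w)"
    by (simp only: matrix_mul_assoc assms)
  then show ?case by (simp add: Cons matrix_mul_assoc)
qed simp

lemma word_prod_pos_semidef:
  assumes "\<And>j. pos_semidef (A j)" "\<And>i j. A i ** A j = A j ** A i"
  shows "pos_semidef (word_prod A w)"
proof (induction w)
  case (Cons j w)
  have "A j ** word_prod A w = word_prod A w ** A j"
    by (rule word_prod_commute) (rule assms(2))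
  then show ?case
    using pos_semidef_mult_commuting[OF assms(1) Cons] by simp
qed (simp add: pos_semidef_mat_1)

section \<open>Words with a single distinguished letter\<close>

lemma word_prod_append: "word_prod A (v @ w) = word_prod A v ** word_prod A w"
  by (induction v) (simp_all add: matrix_mul_assoc)

lemma word_prod_replicate: "word_prod A (replicate k j) = matrix_power (A j) k"
  by (induction k) simp_all

lemma count_list_replicate: "count_list (replicate n a) b = (if a = b then n else 0)"
  by (induction n) auto

text \<open>Such a word is determined by the position \<open>a\<close> of its only letter
  \<open>j\<close>.\<close>

lemma words_of_deg_with_one:
  assumes "i \<noteq> j"
  shows "{w. word_deg w = (\<chi> p. if p = i then k else if p = j then 1 else 0)} =
    (\<lambda>a. replicate a i @ j # replicate (k - a) i) ` {..k}" (is "?L = ?R")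
proof
  show "?R \<subseteq> ?L"
    using assms by (auto simp: word_deg_def vec_eq_iff count_list_replicate)
  show "?L \<subseteq> ?R"
  proof
    fix w assume "w \<in> ?L"
    then have cnt: "\<And>p. count_list w p = (if p = i then k else if p = j then 1 else 0)"
      by (simp add: word_deg_def vec_eq_iff)
    from cnt[of j] assms obtain ys zs where w: "w = ys @ j # zs" and nj: "j \<notin> set ys" "count_list zs j = 0"
      using count_list_Suc_split_first[of w j 0] by auto
    have "p = i" if "p \<in> set ys \<union> set zs" for p
    proof (rule ccontr)
      assume "p \<noteq> i"
      moreover have "p \<noteq> j" using that nj by (auto simp: count_list_0_iff)
      ultimately have "p \<notin> set w" by (simp add: cnt flip: count_list_0_iff)
      then show False using that by (auto simp: w)
    qed
    then have rep: "ys = replicate (length ys) i" "zs = replicate (length zs) i"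
      by (auto intro!: replicate_eqI)
    have "count_list ys i + count_list zs i = k"
      using cnt[of i] assms by (simp add: w)
    then have "length ys + length zs = k"
      using rep by (metis count_list_replicate)
    then show "w \<in> ?R"
      using w rep by (intro image_eqI[of _ _ "length ys"]) auto
  qed
qed

lemma sum_words_of_deg_with_one:
  assumes "i \<noteq> j"
  shows "(\<Sum>w | word_deg w = (\<chi> p. if p = i then k else if p = j then 1 else 0). word_prod A w) =
    sandwich_sum (A i) (A j) k"
proof -
  have "inj_on (\<lambda>a. replicate a i @ j # replicate (k - a) i) {..k}"
  proof (rule inj_on_inverseI)
    \<comment> \<open>The length of the prefix before \<open>j\<close> recovers
      \<open>a\<close>.\<close>
    show "length (takeWhile (\<lambda>p. p \<noteq> j) (replicate a i @ j # replicate (k - a) i)) = a" for a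
      using assms by (simp add: takeWhile_append)
  qed
  then show ?thesis
    unfolding words_of_deg_with_one[OF assms] sandwich_sum_def
    by (simp add: sum.reindex o_def word_prod_append word_prod_replicate matrix_mul_assoc)
qed

theorem mainTheorem8:
  fixes A :: "'d::finite \<Rightarrow> real^'m^'m"
  assumes "\<And>j. pos_semidef (A j)"
  shows "(\<exists>C. power_series_expansion (exp_family A) C) \<and>
    (\<forall>C. power_series_expansion (exp_family A) C \<longrightarrow>
      ((\<forall>\<alpha>. pos_semidef ((-1) ^ multi_deg \<alpha> *\<^sub>R C \<alpha>)) \<longleftrightarrow>
       (\<forall>i j. A i ** A j = A j ** A i)))"
proof -
  have "(\<forall>\<alpha>. pos_semidef ((-1) ^ multi_deg \<alpha> *\<^sub>R exp_coeff A \<alpha>)) \<longleftrightarrow>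
      (\<forall>i j. A i ** A j = A j ** A i)"
  proof (intro iffI allI)
    fix \<alpha> assume "\<forall>i j. A i ** A j = A j ** A i"
    then show "pos_semidef ((-1) ^ multi_deg \<alpha> *\<^sub>R exp_coeff A \<alpha>)"
      unfolding signed_exp_coeff
      by (intro pos_semidef_scaleR pos_semidef_sum word_prod_pos_semidef assms) auto
  next
    fix i j
    assume psd: "\<forall>\<alpha>. pos_semidef ((-1) ^ multi_deg \<alpha> *\<^sub>R exp_coeff A \<alpha>)"
    show "A i ** A j = A j ** A i"
    proof (cases "i = j")
      case False
      show ?thesis
      proof (rule sandwich_sum_pos_semidef_imp_commute[OF assms])
        fix k
        let ?\<alpha> = "(\<chi> p. if p = i then k else if p = j then 1 else 0) :: nat^'d"
        have "pos_semidef ((1 / fact (multi_deg ?\<alpha>)) *\<^sub>R sandwich_sum (A i) (A j) k)"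
          using psd[rule_format, of ?\<alpha>]
          unfolding signed_exp_coeff sum_words_of_deg_with_one[OF False] .
        \<comment> \<open>Multiplying by the factorial cancels the positive factor of the signed
          coefficient.\<close>
        from pos_semidef_scaleR[OF this, of "fact (multi_deg ?\<alpha>)"]
        show "pos_semidef (sandwich_sum (A i) (A j) k)" by simp
      qed
    qed simp
  qed
  \<comment> \<open>\<open>exp_coeff A\<close> witnesses existence; by uniqueness every expansion
    \<open>C\<close> equals it.\<close>
  then show ?thesis
    using power_series_expansion_exp_coeff power_series_expansion_unique by metis
qed

end
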